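(* For any real $p\ge\frac{50}{29}$, with $a:=1/p$, $$\tfrac12\,d_{\mathrm{TV}}(p)=d_{\mathrm{Ko}}(p)<B(a,\tilde x_a),$$ where $$B(a,x):=\frac a{768}\Big(8x\big[5a^2x^2+a(3x^6-7x^4-5x^2-3)+24(x^2+1)\big]\varphi(x)+33a^2(2\Phi(x)-1)\Big)$$ and $\tilde x_a$ is, for any $a\in(0,1)$, the unique real root $x>0$ of the polynomial equation $$P(a,x):=-96(x^4-2x^2-1)-4a(3x^8-28x^6+30x^4+12x^2+3)-a^2(20x^4-60x^2-33)=0.$$
   Context: For real $p>0$ (not necessarily an integer), the density and distribution functions of Student's distribution with $p$ degrees of freedom are $$f_p(x)=\frac{\Gamma\left(\frac{p+1}{2}\right)}{\sqrt{\pi p}\,\Gamma\left(\frac p2\right)}\left(1+\frac{x^2}{p}\right)^{-(p+1)/2},\qquad F_p(x)=\int_{-\infty}^x f_p(u)\,du,\qquad x\in\mathbb{R}.$$ $\varphi$ and $\Phi$ are the density and distribution functions of the standard normal distribution. For real $p>0$, $$d_{\mathrm{Ko}}(p)=\sup_{x\in\mathbb{R}}|F_p(x)-\Phi(x)|,\qquad d_{\mathrm{TV}}(p)=\frac12\int_{-\infty}^\infty|f_p(x)-\varphi(x)|\,dx.$$ *)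

theory Defs
  imports "HOL-Probability.Probability"
begin

definition student_density :: "real \<Rightarrow> real \<Rightarrow> real" where
  "student_density p x =
     Gamma ((p + 1) / 2) / (sqrt (pi * p) * Gamma (p / 2)) *
     (1 + x\<^sup>2 / p) powr (- (p + 1) / 2)"

definition student_cdf :: "real \<Rightarrow> real \<Rightarrow> real" where
  "student_cdf p x = (LINT u:{..x}|lborel. student_density p u)"

definition std_normal_cdf :: "real \<Rightarrow> real" where
  "std_normal_cdf = cdf std_normal_distribution"

definition d_Ko :: "real \<Rightarrow> real" where
  "d_Ko p = (SUP x. \<bar>student_cdf p x - std_normal_cdf x\<bar>)"

definition d_TV :: "real \<Rightarrow> real" where
  "d_TV p = 1 / 2 * (LINT x|lborel. \<bar>student_density p x - std_normal_density x\<bar>)"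

definition B_bound :: "real \<Rightarrow> real \<Rightarrow> real" where
  "B_bound a x = a / 768 *
     (8 * x * (5 * a\<^sup>2 * x\<^sup>2 + a * (3 * x^6 - 7 * x^4 - 5 * x\<^sup>2 - 3) + 24 * (x\<^sup>2 + 1))
        * std_normal_density x
      + 33 * a\<^sup>2 * (2 * std_normal_cdf x - 1))"

definition P_poly :: "real \<Rightarrow> real \<Rightarrow> real" where
  "P_poly a x = - 96 * (x^4 - 2 * x\<^sup>2 - 1)
     - 4 * a * (3 * x^8 - 28 * x^6 + 30 * x^4 + 12 * x\<^sup>2 + 3)
     - a\<^sup>2 * (20 * x^4 - 60 * x\<^sup>2 - 33)"

text \<open>Meaningful only where the positive root exists and is unique.\<close>

definition x_tilde :: "real \<Rightarrow> real" where
  "x_tilde a = (THE x. x > 0 \<and> P_poly a x = 0)"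

end

theory Submission
  imports Defs "HOL-Real_Asymp.Real_Asymp"
begin

text \<open>
  Write \<open>a = 1 / p\<close>, \<open>y = x\<^sup>2\<close>, let \<open>\<phi>\<close> be the standard normal density and \<open>f\<close> the Student density.
  The logarithm of \<open>f / \<phi>\<close> is \<open>l + log_ratio a y\<close>, where the constant \<open>l\<close> comes from a quotient of
  Gamma functions. As a function of \<open>y\<close> it decreases on \<open>[0, 1]\<close> and increases afterwards; since
  \<open>- a / 4 \<le> l \<le> 0\<close> and \<open>log_ratio a 4 \<ge> a / 4\<close>, it changes sign exactly once for \<open>x > 0\<close>, at a point
  \<open>c \<le> 2\<close> (\<open>student_normal_crossing\<close>). The difference \<open>e = \<phi> - f\<close> is even with integral zero, so a
  single sign change forces both distances to be read off from the value at \<open>c\<close> of the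
  primitive \<open>E\<close> of \<open>e\<close>: the supremum of \<open>\<bar>E\<bar>\<close> is \<open>E c\<close> and the integral of \<open>\<bar>e\<bar>\<close> is \<open>4 * E c\<close>
  (\<open>single_crossing\<close>). This is the equality of the two distances up to the factor 2.

  For the upper bound, the derivative of \<open>B_bound a\<close> is \<open>(a / 384) * P_poly a x * \<phi> x\<close>. The function
  \<open>1 - (a / 384) * P_poly a x\<close> is the expansion of \<open>f / \<phi>\<close> to second order in \<open>a\<close> plus a term in
  \<open>a\<^sup>3\<close> which is so low that the function stays below \<open>f / \<phi>\<close> for all \<open>0 \<le> x \<le> 2\<close>
  (\<open>ratio_lower_less\<close>). Hence \<open>B_bound a - E\<close> is strictly increasing on \<open>[0, c]\<close>, and it vanishes
  at 0, so \<open>E c < B_bound a c\<close>. Finally \<open>P_poly a\<close> is positive before its only positive root and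
  negative after it (\<open>P_sq_sign_change\<close>), so \<open>B_bound a\<close> is maximal there on \<open>[0, \<infinity>)\<close>.
\<close>

section \<open>The sign of the polynomial P\<close>

text \<open>
  The polynomial \<open>P_poly a\<close> is even; here it is written in the variable \<open>y = x\<^sup>2\<close> and sorted by
  powers of \<open>a\<close>.
\<close>

definition P_sq :: "real \<Rightarrow> real \<Rightarrow> real" where
  "P_sq a y = 96 * (1 + 2 * y - y\<^sup>2)
     - 4 * a * (3 * y^4 - 28 * y^3 + 30 * y\<^sup>2 + 12 * y + 3)
     + a\<^sup>2 * (33 + 60 * y - 20 * y\<^sup>2)"

lemma P_poly_eq_P_sq: "P_poly a x = P_sq a (x\<^sup>2)"
  unfolding P_poly_def P_sq_def by (simp add: algebra_simps flip: power_mult)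

text \<open>
  With \<open>q\<close> the quartic factor of the term linear in \<open>a\<close>: if \<open>q \<le> 0\<close> the other two terms already suffice,
  and if \<open>q > 0\<close> the worst case of the first two terms is \<open>a = 1\<close>, where they form a polynomial in \<open>y\<close>
  alone.
\<close>

lemma P_sq_pos:
  assumes "0 < a" "a < 1" "0 \<le> y" "y \<le> 2"
  shows "P_sq a y > 0"
proof -
  define q where "q = 3 * y^4 - 28 * y^3 + 30 * y\<^sup>2 + 12 * y + 3"
  have "y * y \<le> 2 * y" using assms by (intro mult_right_mono) auto
  then have y2: "y\<^sup>2 \<le> 2 * y" by (simp add: power2_eq_square)
  have third: "a\<^sup>2 * (33 + 60 * y - 20 * y\<^sup>2) \<ge> 0"
    using y2 assms by (intro mult_nonneg_nonneg) auto
  have "96 * (1 + 2 * y - y\<^sup>2) - 4 * a * q > 0"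
  proof (cases "q \<le> 0")
    case True
    then have "a * q \<le> 0" using assms by (simp add: mult_nonneg_nonpos)
    then show ?thesis using y2 by simp
  next
    case False
    then have "a * q \<le> 1 * q" using assms by (intro mult_right_mono) auto
    moreover have "96 * (1 + 2 * y - y\<^sup>2) - 4 * q > 0"
    proof -
      have "0 < (22 * y - 27)\<^sup>2 + 63" by (intro add_nonneg_pos) auto
      then have "0 \<le> 36 - 54 * y + 22 * y\<^sup>2"
        by (simp add: power2_eq_square algebra_simps)
      then have "0 \<le> y * (36 - 54 * y + 22 * y\<^sup>2)" using assms by simp
      moreover have "0 \<le> y^3 * (6 - 3 * y)" using assms by simp
      ultimately show ?thesis
        unfolding q_def by (simp add: algebra_simps eval_nat_numeral)
    qed
    ultimately show ?thesis by simp
  qed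
  then show ?thesis using third unfolding P_sq_def q_def by simp
qed

text \<open>
  The same case distinction as for \<open>y \<le> 2\<close>, with the signs of the outer terms reversed. At \<open>a = 1\<close>
  the first two terms have only negative coefficients when expanded around \<open>y = 15 / 2\<close>.
\<close>

lemma P_sq_neg:
  assumes "0 < a" "a < 1" "15 / 2 \<le> y"
  shows "P_sq a y < 0"
proof -
  define q where "q = 3 * y^4 - 28 * y^3 + 30 * y\<^sup>2 + 12 * y + 3"
  have "15 / 2 * y \<le> y * y" using assms by (intro mult_right_mono) auto
  then have y2: "15 / 2 * y \<le> y\<^sup>2" by (simp add: power2_eq_square)
  have third: "a\<^sup>2 * (33 + 60 * y - 20 * y\<^sup>2) \<le> 0"
    using y2 assms by (intro mult_nonneg_nonpos) auto
  have "96 * (1 + 2 * y - y\<^sup>2) - 4 * a * q < 0"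
  proof (cases "q \<ge> 0")
    case True
    then have "a * q \<ge> 0" using assms by simp
    then show ?thesis using y2 assms by simp
  next
    case False
    then have "a * q \<ge> 1 * q" using assms by (intro mult_right_mono_neg) auto
    moreover have "96 * (1 + 2 * y - y\<^sup>2) - 4 * q < 0"
    proof -
      define s where "s = y - 15 / 2"
      have s: "y = 15 / 2 + s" "s \<ge> 0" using assms unfolding s_def by auto
      have "96 * (1 + 2 * y - y\<^sup>2) - 4 * q
          = - (6819 / 4 + 4446 * s + 1746 * s\<^sup>2 + 248 * s^3 + 12 * s^4)"
        unfolding q_def s(1) by (simp add: field_simps eval_nat_numeral)
      moreover have "0 < 6819 / 4 + 4446 * s + 1746 * s\<^sup>2 + 248 * s^3 + 12 * s^4"
        using s(2) by (intro add_pos_nonneg) auto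
      ultimately show ?thesis by simp
    qed
    ultimately show ?thesis by simp
  qed
  then show ?thesis using third unfolding P_sq_def q_def by simp
qed


text \<open>
  Since \<open>P_sq a y = 4 * a * M y - N y\<close>, roots with \<open>M y > 0\<close> are the solutions of \<open>N y / M y = 4 * a\<close>,
  and monotonicity of this quotient leaves room for at most one. It holds because the two parts
  of \<open>N\<close>, the one free of \<open>a\<close> and the one with the factor \<open>a\<^sup>2\<close>, each have an increasing quotient
  with \<open>M\<close>.
\<close>

lemma P_sq_quotient_strict_mono:
  fixes a :: real
  defines "N \<equiv> \<lambda>y. 96 * (y\<^sup>2 - 2 * y - 1) + a\<^sup>2 * (20 * y\<^sup>2 - 60 * y - 33)"
    and "M \<equiv> \<lambda>y. - (3 * y^4 - 28 * y^3 + 30 * y\<^sup>2 + 12 * y + 3 :: real)"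
  shows "y \<in> {2..15/2} \<Longrightarrow> M y > 0"
    and "\<lbrakk>2 \<le> u; u < v; v \<le> 15 / 2\<rbrakk> \<Longrightarrow> N u / M u < N v / M v"
proof -
  show M_pos: "M y > 0" if y: "y \<in> {2..15/2}" for y
  proof -
    define t where "t = y - 2"
    have t: "y = 2 + t" "0 \<le> t" "t \<le> 11 / 2" using y unfolding t_def by auto
    \<comment> \<open>expansion around 2: for \<open>t \<le> 11 / 2\<close> the quadratic factor is at most 3\<close>
    have "t * t \<le> 11 / 2 * t" using t by (intro mult_right_mono) auto
    then have t2: "t\<^sup>2 \<le> 11 / 2 * t" by (simp add: power2_eq_square)
    then have "t\<^sup>2 * (3 * t\<^sup>2 - 4 * t - 66) \<le> t\<^sup>2 * 3"
      using t by (intro mult_left_mono) auto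
    moreover have "M y = 29 + 108 * t - t\<^sup>2 * (3 * t\<^sup>2 - 4 * t - 66)"
      unfolding M_def t(1) by algebra
    ultimately show ?thesis using t t2 by simp
  qed
  assume uv: "2 \<le> u" "u < v" "v \<le> 15 / 2"
  show "N u / M u < N v / M v"
  proof (rule DERIV_pos_imp_increasing[OF uv(2)])
    fix y assume "u \<le> y" "y \<le> v"
    then have y: "2 \<le> y" "y \<le> 15 / 2" using uv by auto
    then have M: "M y > 0" by (intro M_pos) auto
    define N' where "N' = 96 * (2 * y - 2) + a\<^sup>2 * (40 * y - 60)"
    define M' where "M' = - (12 * y^3 - 84 * y\<^sup>2 + 60 * y + 12)"
    have "((\<lambda>y. N y / M y) has_real_derivative (N' * M y - N y * M') / (M y * M y)) (at y)"
      unfolding N_def M_def N'_def M'_def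
      by (rule derivative_eq_intros refl | use M in \<open>simp add: M_def\<close>)+
    moreover have "N' * M y - N y * M' > 0"
    proof -
      have y2: "2 * y \<le> y\<^sup>2" "4 * y \<le> y^3"
        using y mult_mono[of 2 y 2 y] mult_right_mono[of 2 y y]
          mult_right_mono[of 4 "y * y" y] by (auto simp: power2_eq_square power3_eq_cube)
      have T1: "0 < y^3 * (6 * y\<^sup>2 - 46 * y + 100) + 12 * y\<^sup>2 - 66 * y - 6"
      proof -
        have "0 \<le> (12 * y - 46)\<^sup>2" by simp
        then have "23 / 2 \<le> 6 * y\<^sup>2 - 46 * y + 100"
          by (simp add: power2_eq_square algebra_simps)
        then have "y^3 * (23 / 2) \<le> y^3 * (6 * y\<^sup>2 - 46 * y + 100)"
          using y by (intro mult_left_mono) auto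
        then show ?thesis using y y2 by linarith
      qed
      have T2: "0 < y^3 * (120 * y\<^sup>2 - 1100 * y + 2964) + 732 * y\<^sup>2 - 2100 * y - 216"
      proof -
        have "0 \<le> (240 * y - 1100)\<^sup>2" by simp
        then have "443 \<le> 120 * y\<^sup>2 - 1100 * y + 2964"
          by (simp add: power2_eq_square algebra_simps)
        then have "y^3 * 443 \<le> y^3 * (120 * y\<^sup>2 - 1100 * y + 2964)"
          using y by (intro mult_left_mono) auto
        then show ?thesis using y y2 by linarith
      qed
      \<comment> \<open>the numerators of the derivatives of the two partial quotients, as polynomials in \<open>y\<close>\<close>
      have "N' * M y - N y * M' =
          96 * (y^3 * (6 * y\<^sup>2 - 46 * y + 100) + 12 * y\<^sup>2 - 66 * y - 6)
          + a\<^sup>2 * (y^3 * (120 * y\<^sup>2 - 1100 * y + 2964) + 732 * y\<^sup>2 - 2100 * y - 216)"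
        unfolding N'_def M'_def N_def M_def by algebra
      also have "\<dots> > 0"
        by (intro add_pos_nonneg mult_pos_pos mult_nonneg_nonneg T1 T2[THEN less_imp_le]) auto
      finally show ?thesis .
    qed
    ultimately show "\<exists>d. ((\<lambda>y. N y / M y) has_real_derivative d) (at y) \<and> d > 0"
      using M by (intro exI[of _ "(N' * M y - N y * M') / (M y * M y)"]) simp
  qed
qed

text \<open>
  Outside \<open>[2, 15 / 2]\<close> the sign is known; inside, the sign of \<open>P_sq a\<close> is that of \<open>4 * a - N / M\<close>, which is
  strictly decreasing.
\<close>

lemma P_sq_sign_change:
  assumes "0 < a" "a < 1"
  obtains Y where "2 < Y" "P_sq a Y = 0"
    "\<And>y. 0 \<le> y \<Longrightarrow> y < Y \<Longrightarrow> P_sq a y > 0"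
    "\<And>y. Y < y \<Longrightarrow> P_sq a y < 0"
proof -
  define N where "N = (\<lambda>y::real. 96 * (y\<^sup>2 - 2 * y - 1) + a\<^sup>2 * (20 * y\<^sup>2 - 60 * y - 33))"
  define M where "M = (\<lambda>y::real. - (3 * y^4 - 28 * y^3 + 30 * y\<^sup>2 + 12 * y + 3))"
  have M_pos: "M y > 0" if "2 \<le> y" "y \<le> 15 / 2" for y
    using P_sq_quotient_strict_mono(1)[of y] that unfolding M_def by simp
  have mono: "N u / M u < N v / M v" if "2 \<le> u" "u < v" "v \<le> 15 / 2" for u v
    using P_sq_quotient_strict_mono(2)[OF that, of a] unfolding M_def N_def by simp
  have P_eq: "P_sq a y = M y * (4 * a - N y / M y)" if "2 \<le> y" "y \<le> 15 / 2" for y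
  proof -
    have "P_sq a y = 4 * a * M y - N y" unfolding P_sq_def M_def N_def by algebra
    then show ?thesis using M_pos[OF that] by (simp add: right_diff_distrib)
  qed
  have "\<exists>Y\<ge>2. Y \<le> 15 / 2 \<and> P_sq a Y = 0"
    using P_sq_pos[OF assms, of 2] P_sq_neg[OF assms, of "15/2"]
    by (intro IVT2) (auto simp: P_sq_def intro!: continuous_intros isCont_diff)
  then obtain Y where Y: "2 \<le> Y" "Y \<le> 15 / 2" "P_sq a Y = 0" by auto
  have ne: "Y \<noteq> 2" using Y(3) P_sq_pos[OF assms, of 2] by force
  have root: "N Y / M Y = 4 * a" using P_eq[OF Y(1,2)] Y(3) M_pos[OF Y(1,2)] by simp
  show ?thesis
  proof (rule that[of Y])
    show "2 < Y" "P_sq a Y = 0" using Y ne by auto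
    show "P_sq a y > 0" if "0 \<le> y" "y < Y" for y
    proof (cases "y \<le> 2")
      case False
      then show ?thesis
        using mono[of y Y] that Y root P_eq[of y] M_pos[of y] by simp
    qed (use P_sq_pos[OF assms] that in auto)
    show "P_sq a y < 0" if "Y < y" for y
    proof (cases "15 / 2 \<le> y")
      case False
      then show ?thesis
        using mono[of Y y] that Y root P_eq[of y] M_pos[of y] by (simp add: mult_pos_neg)
    qed (use P_sq_neg[OF assms] in auto)
  qed
qed

section \<open>The logarithm of the density ratio\<close>

text \<open>
  The part of \<open>ln (f x / \<phi> x)\<close> that depends on \<open>y = x\<^sup>2\<close>, for the Student density \<open>f\<close> with \<open>1 / a\<close>
  degrees of freedom and the normal density \<open>\<phi>\<close>; it vanishes at \<open>y = 0\<close>.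
\<close>

definition log_ratio :: "real \<Rightarrow> real \<Rightarrow> real" where
  "log_ratio a y = y / 2 - (1 + a) / (2 * a) * ln (1 + a * y)"

lemma log_ratio_has_derivative:
  assumes "0 < a" "0 \<le> y"
  shows "(log_ratio a has_real_derivative a * (y - 1) / (2 * (1 + a * y))) (at y)"
proof -
  have pos: "1 + a * y > 0" using assms by (intro add_pos_nonneg) auto
  have "(log_ratio a has_real_derivative 1 / 2 - (1 + a) / (2 * a) * (a / (1 + a * y))) (at y)"
    unfolding log_ratio_def[abs_def]
    by (rule derivative_eq_intros refl | use pos in simp)+
  moreover have "1 / 2 - (1 + a) / (2 * a) * (a / (1 + a * y)) = a * (y - 1) / (2 * (1 + a * y))"
    using assms pos by (simp add: divide_simps) (simp add: algebra_simps)
  ultimately show ?thesis by simp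
qed

text \<open>
  This places the crossing of the two densities at some \<open>x \<le> 2\<close>. After multiplication by
  \<open>2 * a / (1 + a)\<close> the difference of the two sides vanishes at \<open>a = 0\<close>, and the sign of its
  derivative is that of \<open>7 - 17 / 2 * a - 2 * a\<^sup>2\<close>, which is positive on the whole range of \<open>a\<close>.
\<close>

lemma log_ratio_at_4:
  assumes "0 < a" "a \<le> 29 / 50"
  shows "log_ratio a 4 \<ge> a / 4"
proof -
  define w where "w = (\<lambda>x::real. (4 * x - x\<^sup>2 / 2) / (1 + x) - ln (1 + 4 * x))"
  have "w 0 \<le> w a"
  proof (rule DERIV_nonneg_imp_nondecreasing[where f = w])
    fix x assume x: "0 \<le> x" "x \<le> a"
    define D where "D = x * (7 - 17 / 2 * x - 2 * x\<^sup>2) / ((1 + x)\<^sup>2 * (1 + 4 * x))"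
    have nz: "1 + x > 0" "1 + 4 * x > 0" using x by auto
    have "(w has_real_derivative
        ((4 - x) * (1 + x) - (4 * x - x\<^sup>2 / 2)) / (1 + x)\<^sup>2 - 4 / (1 + 4 * x)) (at x)"
      unfolding w_def
      by (rule derivative_eq_intros refl | use nz in \<open>simp add: power2_eq_square\<close>)+
    also have "((4 - x) * (1 + x) - (4 * x - x\<^sup>2 / 2)) / (1 + x)\<^sup>2 - 4 / (1 + 4 * x) = D"
      unfolding D_def using nz
      by (simp add: divide_simps) (simp add: algebra_simps eval_nat_numeral)
    finally have "(w has_real_derivative D) (at x)" .
    moreover have "x * x \<le> 29 / 50 * x" using x assms by (intro mult_right_mono) auto
    then have "D \<ge> 0"
      unfolding D_def using x nz assms
      by (intro divide_nonneg_nonneg mult_nonneg_nonneg) (auto simp: power2_eq_square)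
    ultimately show "\<exists>d. (w has_real_derivative d) (at x) \<and> d \<ge> 0" by blast
  qed (use assms in auto)
  then have "ln (1 + 4 * a) \<le> (4 * a - a\<^sup>2 / 2) / (1 + a)" by (simp add: w_def)
  then have "(1 + a) / (2 * a) * ln (1 + 4 * a) \<le> (1 + a) / (2 * a) * ((4 * a - a\<^sup>2 / 2) / (1 + a))"
    using assms by (intro mult_left_mono) auto
  also have "\<dots> = 2 - a / 4"
    using assms by (simp add: divide_simps) (simp add: algebra_simps eval_nat_numeral)
  finally show ?thesis by (simp add: log_ratio_def mult.commute)
qed

section \<open>A polynomial lower bound for the density ratio\<close>

text \<open>
  The lower bound for \<open>f x / \<phi> x\<close> at \<open>y = x\<^sup>2\<close>, whose integrated form is \<open>B_bound\<close>.
\<close>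

definition ratio_lower :: "real \<Rightarrow> real \<Rightarrow> real" where
  "ratio_lower a y = 1 - a / 384 * P_sq a y"

text \<open>
  Up to the factor \<open>a\<^sup>3 / 384\<close> this polynomial is \<open>2 * (1 + a * y) * h' - a * (y - 1) * h\<close> for
  \<open>h = ratio_lower a\<close>; it decides whether \<open>h * exp (- log_ratio a)\<close> decreases. The lower powers of
  \<open>a\<close> cancel because \<open>h\<close> agrees with the density ratio to second order.
\<close>

lemma defect_polynomial_neg_outer:
  fixes a y :: real
  assumes "0 \<le> a" "a \<le> 1" "1 \<le> y" "y \<le> 4"
  shows "(- 12 * y^5 + 220 * y^4 - 904 * y^3 + 552 * y\<^sup>2 + 212 * y - 108)
       + a * (- 20 * y^3 + 160 * y\<^sup>2 - 147 * y - 33) < 0"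
proof -
  define s where "s = y - 1"
  have s: "y = 1 + s" "0 \<le> s" "s \<le> 3" using assms unfolding s_def by auto
  have "s * s \<le> 3 * s" using s by (intro mult_right_mono) auto
  then have s2: "s\<^sup>2 \<le> 3 * s" by (simp add: power2_eq_square)
  have "s\<^sup>2 * (160 * s\<^sup>2 - 144 * s - 960) \<le> s\<^sup>2 * 48"
    using s s2 by (intro mult_left_mono) auto
  moreover have "a * (113 * s + 100 * s\<^sup>2) \<le> 1 * (113 * s + 100 * s\<^sup>2)"
    using assms s by (intro mult_right_mono) auto
  moreover have "0 \<le> a * (40 + 20 * s^3)" "0 \<le> 12 * s^5" using assms s by auto
  ultimately have "- 40 - 576 * s + s\<^sup>2 * (160 * s\<^sup>2 - 144 * s - 960) - 12 * s^5
       + a * (113 * s + 100 * s\<^sup>2) - a * (40 + 20 * s^3)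
     \<le> - 40 - 576 * s + s\<^sup>2 * 48 - 0 + 1 * (113 * s + 100 * s\<^sup>2) - 0"
    by (intro add_mono diff_mono order_refl)
  also have "\<dots> < 0" using s s2 by simp
  also have "- 40 - 576 * s + s\<^sup>2 * (160 * s\<^sup>2 - 144 * s - 960) - 12 * s^5
       + a * (113 * s + 100 * s\<^sup>2) - a * (40 + 20 * s^3) = (- 12 * y^5 + 220 * y^4 - 904 * y^3 + 552 * y\<^sup>2 + 212 * y - 108)
       + a * (- 20 * y^3 + 160 * y\<^sup>2 - 147 * y - 33)"
    unfolding s(1) by algebra
  finally show ?thesis .
qed

text \<open>
  For small \<open>a\<close> the defect of \<open>ratio_lower a\<close> itself is positive on a part of \<open>[0, 1]\<close>. Here it is the defect of
  \<open>ratio_lower a y + 7 / 96 * a^3 * (1 - y)\<close>, in which the slope of the added term has lowered the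
  constant coefficient by 56.
\<close>

lemma defect_polynomial_neg_inner:
  fixes a y :: real
  assumes "0 \<le> a" "0 \<le> y" "y \<le> 1"
  shows "(- 12 * y^5 + 220 * y^4 - 904 * y^3 + 552 * y\<^sup>2 + 212 * y - 164)
       + a * (- 20 * y^3 + 188 * y\<^sup>2 - 259 * y - 5) < 0"
proof -
  have "y * y \<le> 1 * y" using assms by (intro mult_right_mono) auto
  then have y2: "y\<^sup>2 \<le> y" by (simp add: power2_eq_square)
  have "a * (- 20 * y^3 + 188 * y\<^sup>2 - 259 * y - 5) \<le> 0"
    using assms y2 zero_le_power[of y 3] by (intro mult_nonneg_nonpos) linarith+
  \<comment> \<open>the \<open>a\<close>-free part is negative but close to zero near \<open>y = 2 / 3\<close>, whence this square factor\<close>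
  moreover have "0 \<le> (y - 2 / 3)\<^sup>2 * (- 220 * y\<^sup>2 + 1832 / 3 * y + 360)"
    using assms y2 by (intro mult_nonneg_nonneg) auto
  moreover have "- 12 * y^5 + 220 * y^4 - 904 * y^3 + 552 * y\<^sup>2 + 212 * y - 164
     = - ((y - 2 / 3)\<^sup>2 * (- 220 * y\<^sup>2 + 1832 / 3 * y + 360)) - (4 - 92 / 27 * y) - 12 * y^5"
    by (simp add: field_simps eval_nat_numeral)
  moreover have "0 \<le> 12 * y^5" using assms by simp
  ultimately show ?thesis using assms by linarith
qed

lemma ratio_lower_has_derivative:
  "(ratio_lower a has_real_derivative
     - a / 384 * (96 * (2 - 2 * y) - 4 * a * (12 * y^3 - 84 * y\<^sup>2 + 60 * y + 12)
        + a\<^sup>2 * (60 - 40 * y))) (at y)"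
  unfolding ratio_lower_def[abs_def] P_sq_def
  by (rule derivative_eq_intros refl | simp)+

text \<open>
  The logarithmic derivative of \<open>exp (log_ratio a)\<close> is \<open>a * (y - 1) / (2 * (1 + a * y))\<close>; after
  clearing this denominator, the sign of the derivative of \<open>k * exp (- log_ratio a)\<close> is a question
  about polynomials whenever \<open>k\<close> is one.
\<close>

lemma scaled_mult_exp_strict_antimono:
  assumes a: "0 < a" and "0 \<le> u" "u < v"
    and deriv: "\<And>y. u \<le> y \<Longrightarrow> y \<le> v \<Longrightarrow> (k has_real_derivative k' y) (at y)"
    and defect: "\<And>y. u \<le> y \<Longrightarrow> y \<le> v \<Longrightarrow> 2 * (1 + a * y) * k' y - a * (y - 1) * k y < 0"
  shows "k v * exp (- log_ratio a v) < k u * exp (- log_ratio a u)"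
proof (rule DERIV_neg_imp_decreasing[OF \<open>u < v\<close>])
  fix y assume y: "u \<le> y" "y \<le> v"
  then have y0: "0 \<le> y" using assms by simp
  then have pos: "1 + a * y > 0" using a by (intro add_pos_nonneg) auto
  define D where "D = exp (- log_ratio a y) / (2 * (1 + a * y)) *
      (2 * (1 + a * y) * k' y - a * (y - 1) * k y)"
  have "((\<lambda>y. k y * exp (- log_ratio a y)) has_real_derivative D) (at y)"
    by (rule derivative_eq_intros deriv y log_ratio_has_derivative[OF a y0] refl)+
       (use pos in \<open>simp add: D_def field_simps\<close>)
  moreover have "D < 0"
    unfolding D_def using defect[OF y] pos by (intro mult_pos_neg) auto
  ultimately show "\<exists>d. ((\<lambda>y. k y * exp (- log_ratio a y)) has_real_derivative d) (at y) \<and> d < 0"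
    by blast
qed

text \<open>
  The coefficient of \<open>a\<^sup>3\<close> on the left is \<open>- 33 / 384 + 28 / 384 = - 5 / 384\<close>, less than the
  Taylor coefficient \<open>- 1 / 384\<close> of \<open>exp (- a / 4)\<close>, and the lower coefficients agree. It is this gap
  that limits the correction term on \<open>[0, 1]\<close>.
\<close>

lemma ratio_lower_at_zero:
  assumes "0 < a"
  shows "ratio_lower a 0 + 7 / 96 * a^3 < exp (- a / 4)"
proof -
  define w where "w = (\<lambda>a::real. (1 - a / 4 + a\<^sup>2 / 32 - 5 * a^3 / 384) * exp (a / 4))"
  have "w a < w 0"
  proof (rule DERIV_neg_imp_decreasing_open[OF assms])
    fix x :: real assume x: "0 < x" "x < a"
    have "(w has_real_derivative - (12 * x\<^sup>2 / 384 + 5 * x^3 / 1536) * exp (x / 4)) (at x)"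
      unfolding w_def
      by (rule derivative_eq_intros refl | simp)+ (simp add: field_simps eval_nat_numeral)
    moreover have "12 * x\<^sup>2 / 384 + 5 * x^3 / 1536 > 0"
      using x by (intro add_pos_pos) auto
    then have "- (12 * x\<^sup>2 / 384 + 5 * x^3 / 1536) * exp (x / 4) < 0"
      by (intro mult_neg_pos) auto
    ultimately show "\<exists>d. (w has_real_derivative d) (at x) \<and> d < 0" by blast
  next
    show "continuous_on {0..a} w" unfolding w_def by (intro continuous_intros) auto
  qed
  then have "(1 - a / 4 + a\<^sup>2 / 32 - 5 * a^3 / 384) * exp (a / 4) < 1" by (simp add: w_def)
  then have "1 - a / 4 + a\<^sup>2 / 32 - 5 * a^3 / 384 < exp (- a / 4)"
    by (simp add: exp_minus field_simps)
  moreover have "ratio_lower a 0 + 7 / 96 * a^3 = 1 - a / 4 + a\<^sup>2 / 32 - 5 * a^3 / 384"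
    unfolding ratio_lower_def P_sq_def by (simp add: field_simps eval_nat_numeral)
  ultimately show ?thesis by simp
qed

text \<open>
  The quotient of both sides is below 1 at \<open>y = 0\<close> and would stay so if it were decreasing. It
  is decreasing on \<open>[1, 4]\<close>. On \<open>[0, 1]\<close> the left side is replaced by the larger function \<open>k\<close>, which
  equals it at \<open>y = 1\<close>, still lies below at \<open>y = 0\<close>, and does have a decreasing quotient. The constant
  \<open>7 / 96\<close> in \<open>k\<close> must be at most \<open>1 / 12\<close> for the inequality at 0, and large enough to make the
  defect negative.
\<close>

lemma ratio_lower_less:
  assumes a: "0 < a" "a \<le> 1" and y: "0 \<le> y" "y \<le> 4"
  shows "ratio_lower a y < exp (- a / 4 + log_ratio a y)"
proof -
  define h' where "h' = (\<lambda>y. - a / 384 * (96 * (2 - 2 * y)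
      - 4 * a * (12 * y^3 - 84 * y\<^sup>2 + 60 * y + 12) + a\<^sup>2 * (60 - 40 * y)))"
  define k where "k = (\<lambda>y. ratio_lower a y + 7 / 96 * a^3 * (1 - y))"
  have inner: "k y * exp (- log_ratio a y) < exp (- a / 4)" if y: "0 \<le> y" "y \<le> 1" for y
  proof (cases "y = 0")
    case True
    then show ?thesis using ratio_lower_at_zero[OF a(1)] by (simp add: k_def log_ratio_def)
  next
    case False
    have "k y * exp (- log_ratio a y) < k 0 * exp (- log_ratio a 0)"
    proof (rule scaled_mult_exp_strict_antimono[OF a(1), where k' = "\<lambda>y. h' y - 7 / 96 * a^3"])
      fix t :: real assume t: "0 \<le> t" "t \<le> y"
      show "(k has_real_derivative h' t - 7 / 96 * a^3) (at t)"
        unfolding k_def h'_def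
        by (rule derivative_eq_intros ratio_lower_has_derivative refl | simp)+
      have "2 * (1 + a * t) * (h' t - 7 / 96 * a^3) - a * (t - 1) * k t = a^3 / 384 *
         ((- 12 * t^5 + 220 * t^4 - 904 * t^3 + 552 * t\<^sup>2 + 212 * t - 164)
           + a * (- 20 * t^3 + 188 * t\<^sup>2 - 259 * t - 5))"
        unfolding h'_def k_def ratio_lower_def P_sq_def
        by (simp add: field_simps eval_nat_numeral)
      also have "\<dots> < 0"
        using a t y by (intro mult_pos_neg defect_polynomial_neg_inner) auto
      finally show "2 * (1 + a * t) * (h' t - 7 / 96 * a^3) - a * (t - 1) * k t < 0" .
    qed (use False y in auto)
    then show ?thesis using ratio_lower_at_zero[OF a(1)] by (simp add: k_def log_ratio_def)
  qed
  have "ratio_lower a y * exp (- log_ratio a y) < exp (- a / 4)"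
  proof (cases "y \<le> 1")
    case True
    have "ratio_lower a y * exp (- log_ratio a y) \<le> k y * exp (- log_ratio a y)"
      using a True by (intro mult_right_mono) (auto simp: k_def)
    then show ?thesis using inner[OF y(1) True] by linarith
  next
    case False
    have "ratio_lower a y * exp (- log_ratio a y) < ratio_lower a 1 * exp (- log_ratio a 1)"
    proof (rule scaled_mult_exp_strict_antimono[OF a(1), where k' = h'])
      fix t :: real assume t: "1 \<le> t" "t \<le> y"
      show "(ratio_lower a has_real_derivative h' t) (at t)"
        unfolding h'_def by (rule ratio_lower_has_derivative)
      have "2 * (1 + a * t) * h' t - a * (t - 1) * ratio_lower a t = a^3 / 384 *
         ((- 12 * t^5 + 220 * t^4 - 904 * t^3 + 552 * t\<^sup>2 + 212 * t - 108)
           + a * (- 20 * t^3 + 160 * t\<^sup>2 - 147 * t - 33))"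
        unfolding h'_def ratio_lower_def P_sq_def
        by (simp add: field_simps eval_nat_numeral)
      also have "\<dots> < 0"
        using a t y by (intro mult_pos_neg defect_polynomial_neg_outer) auto
      finally show "2 * (1 + a * t) * h' t - a * (t - 1) * ratio_lower a t < 0" .
    qed (use False in auto)
    then show ?thesis using inner[of 1] by (simp add: k_def)
  qed
  then have "ratio_lower a y * exp (- log_ratio a y) * exp (log_ratio a y)
      < exp (- a / 4) * exp (log_ratio a y)"
    by (rule mult_strict_right_mono) simp
  then show ?thesis by (simp add: mult.assoc flip: exp_add)
qed

section \<open>The Gamma quotient in the Student density\<close>

lemma ln_Gamma_plus1:
  fixes x :: real
  assumes "x > 0"
  shows "ln (Gamma (x + 1)) = ln x + ln (Gamma x)"
proof -
  have "x \<notin> \<int>\<^sub>\<le>\<^sub>0" using assms by (auto elim!: nonpos_Ints_cases)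
  then show ?thesis using assms Gamma_real_pos[OF assms]
    by (simp add: Gamma_plus1 ln_mult_pos del: Gamma_real_pos)
qed

text \<open>
  Log-convexity of \<open>Gamma\<close> at the midpoint of \<open>z\<close> and \<open>z + 1\<close>.
\<close>

lemma Gamma_half_le:
  fixes z :: real
  assumes "z > 0"
  shows "ln (Gamma (z + 1 / 2)) \<le> ln (Gamma z) + ln z / 2"
proof -
  have "(ln \<circ> Gamma) ((1 - 1 / 2) *\<^sub>R z + (1 / 2) *\<^sub>R (z + 1))
      \<le> (1 - 1 / 2) * (ln \<circ> Gamma) z + (1 / 2) * (ln \<circ> Gamma) (z + 1)"
    using assms by (intro convex_onD[OF log_convex_Gamma_real]) auto
  moreover have "(1 - 1 / 2) *\<^sub>R z + (1 / 2) *\<^sub>R (z + 1) = z + 1 / 2" by (simp add: field_simps)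
  ultimately show ?thesis using ln_Gamma_plus1[OF assms] by (simp add: field_simps)
qed

text \<open>
  Let \<open>L z\<close> be the difference of the two sides. Then \<open>L (z + 1) \<le> L z\<close> by
  \<open>ln (1 + u) \<le> u\<close> with \<open>u = 1 / (4 * z * (z + 1))\<close>, because \<open>(z + 1 / 2)\<^sup>2 = z * (z + 1) * (1 + u)\<close>.
  The claim \<open>L z \<ge> 0\<close> follows because along \<open>z + n\<close> the values have a lower bound that tends to 0,
  by the upper estimate applied at \<open>z + n + 1 / 2\<close>.
\<close>

lemma Gamma_half_ge:
  fixes z :: real
  assumes "z > 0"
  shows "ln (Gamma (z + 1 / 2)) \<ge> ln (Gamma z) + ln z / 2 - 1 / (8 * z)"
proof -
  define L where "L = (\<lambda>z::real. ln (Gamma (z + 1 / 2)) - ln (Gamma z) - ln z / 2 + 1 / (8 * z))"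
  have step: "L (x + 1) \<le> L x" if x: "x > 0" for x
  proof -
    define w where "w = x * (x + 1)"
    have w: "w > 0" unfolding w_def using x by simp
    have "ln (x + 1 / 2) * 2 = ln ((x + 1 / 2)\<^sup>2)" using x by (simp add: ln_realpow)
    also have "(x + 1 / 2)\<^sup>2 = w * (1 + 1 / (4 * w))"
      using w by (simp add: field_simps) (simp add: w_def algebra_simps power2_eq_square)
    also have "ln \<dots> = ln w + ln (1 + 1 / (4 * w))"
      using w by (intro ln_mult_pos add_pos_pos) auto
    also have "ln (1 + 1 / (4 * w)) \<le> 1 / (4 * w)" using w by (intro ln_add_one_self_le_self) auto
    also have "ln w = ln x + ln (x + 1)" unfolding w_def using x by (simp add: ln_mult)
    finally have "ln (x + 1 / 2) \<le> ln x / 2 + ln (x + 1) / 2 + 1 / (8 * w)" by simp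
    moreover have "1 / (8 * x) - 1 / (8 * (x + 1)) = 1 / (8 * w)"
      unfolding w_def using x by (simp add: field_simps)
    moreover have "L x - L (x + 1) = ln x - ln (x + 1 / 2) + (ln (x + 1) - ln x) / 2
        + (1 / (8 * x) - 1 / (8 * (x + 1)))"
      unfolding L_def using ln_Gamma_plus1[of x] ln_Gamma_plus1[of "x + 1 / 2"] x
      by (simp add: algebra_simps diff_divide_distrib)
    ultimately show ?thesis by (simp add: diff_divide_distrib)
  qed
  have le: "L (z + real n) \<le> L z" for n
  proof (induction n)
    case (Suc n)
    have "L (z + real n + 1) \<le> L (z + real n)" using assms by (intro step) auto
    then show ?case using Suc.IH by (simp add: add_ac)
  qed simp
  have "(ln (z + real n) - ln (z + real n + 1 / 2)) / 2 \<le> L z" for n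
  proof -
    define x where "x = z + real n"
    have x: "x > 0" unfolding x_def using assms by simp
    have "ln x / 2 - ln (x + 1 / 2) / 2 \<le> L x"
    proof -
      have "0 \<le> 1 / (8 * x)" using x by simp
      moreover have "ln (Gamma (x + 1)) \<le> ln (Gamma (x + 1 / 2)) + ln (x + 1 / 2) / 2"
        using Gamma_half_le[of "x + 1 / 2"] x by (simp add: add.assoc)
      ultimately show ?thesis
        unfolding L_def using ln_Gamma_plus1[OF x] by linarith
    qed
    then show ?thesis using le[of n] by (simp add: x_def diff_divide_distrib)
  qed
  moreover have "(\<lambda>n. (ln (z + real n) - ln (z + real n + 1 / 2)) / 2) \<longlonglongrightarrow> 0"
    by real_asymp
  ultimately have "0 \<le> L z" by (intro LIMSEQ_le_const2) blast+
  then show ?thesis by (simp add: L_def)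
qed

section \<open>Total mass of the Student density\<close>

text \<open>
  On the positive half-line, the substitution \<open>x = sqrt (p * t / (1 - t))\<close>, for which
  \<open>1 + x\<^sup>2 / p = 1 / (1 - t)\<close>, turns the integral into the Beta integral; the kernel is even.
\<close>

lemma student_kernel_integral:
  fixes p :: real
  assumes p: "p > 0"
  shows "has_bochner_integral lborel (\<lambda>x. (1 + x\<^sup>2 / p) powr (- (p + 1) / 2))
           (sqrt p * Beta (1 / 2) (p / 2))"
proof -
  define f where "f = (\<lambda>x::real. (1 + x\<^sup>2 / p) powr (- (p + 1) / 2))"
  define g where "g = (\<lambda>t::real. sqrt p * t powr (1 / 2) * (1 - t) powr (- 1 / 2))"
  define g' where "g' = (\<lambda>t::real. sqrt p / 2 * t powr (- 1 / 2) * (1 - t) powr (- 3 / 2))"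
  define b where "b = (\<lambda>t::real. t powr (1 / 2 - 1) * (1 - t) powr (p / 2 - 1))"
  have base: "1 + x\<^sup>2 / p > 0" for x using p by (intro add_pos_nonneg) auto
  have fg: "f (g t) * g' t = sqrt p / 2 * b t" if t: "0 < t" "t < 1" for t
  proof -
    have "(g t)\<^sup>2 = p * (t / (1 - t))"
      unfolding g_def using t p
      by (simp add: power_mult_distrib power_divide powr_minus_divide powr_half_sqrt)
    then have eq: "1 + (g t)\<^sup>2 / p = (1 - t) powr (- 1)"
      using t p by (simp add: powr_minus_divide field_simps)
    have "f (g t) = (1 - t) powr ((p + 1) / 2)"
      unfolding f_def eq powr_powr by (simp add: field_simps)
    moreover have "(1 - t) powr ((p + 1) / 2) * (1 - t) powr (- 3 / 2) = (1 - t) powr (p / 2 - 1)"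
      unfolding powr_add[symmetric]
      by (rule arg_cong[where f = "\<lambda>r. _ powr r"]) (simp add: field_simps)
    ultimately show ?thesis
      unfolding g'_def b_def by (simp add: mult_ac)
  qed
  have b_int: "set_integrable lborel {0<..<1} b"
    using integrable_Beta[of "1 / 2" "p / 2"] p unfolding b_def
    by - (rule set_integrable_subset[of _ "{0..1}"], auto)
  have subst: "set_integrable lborel (einterval 0 \<infinity>) f"
      "(LBINT x=0..\<infinity>. f x) = (LBINT t=0..1. f (g t) * g' t)"
  proof -
    have 1: "DERIV g t :> g' t" if "0 < ereal t" "ereal t < 1" for t
    proof -
      have t: "0 < t" "t < 1" using that by auto
      have "((\<lambda>t. sqrt p * t powr (1 / 2) * (1 - t) powr (- 1 / 2)) has_real_derivative
         sqrt p * (1 / 2 * t powr (1 / 2 - 1)) * (1 - t) powr (- 1 / 2)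
         + sqrt p * t powr (1 / 2) * (- 1 / 2 * (1 - t) powr (- 1 / 2 - 1) * (- 1))) (at t)"
        using t by (auto intro!: derivative_eq_intros simp: field_simps)
      also have "sqrt p * (1 / 2 * t powr (1 / 2 - 1)) * (1 - t) powr (- 1 / 2)
         + sqrt p * t powr (1 / 2) * (- 1 / 2 * (1 - t) powr (- 1 / 2 - 1) * (- 1)) = g' t"
      proof -
        have e: "(1 - t) powr (- 1 / 2) = (1 - t) * (1 - t) powr (- 3 / 2)"
          "t powr (1 / 2) = t * t powr (- 1 / 2)"
          "1 / 2 - 1 = (- 1 / 2 :: real)" "- 1 / 2 - 1 = (- 3 / 2 :: real)"
          using t by (simp_all add: powr_mult_base)
        show ?thesis unfolding g'_def e by (simp add: field_simps)
      qed
      finally show ?thesis unfolding g_def .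
    qed
    have A: "((ereal \<circ> g \<circ> real_of_ereal) \<longlongrightarrow> 0) (at_right 0)"
    proof -
      have "(g \<longlongrightarrow> 0) (at_right 0)" unfolding g_def by real_asymp
      then show ?thesis by (simp add: ereal_tendsto_simps zero_ereal_def)
    qed
    have B: "((ereal \<circ> g \<circ> real_of_ereal) \<longlongrightarrow> \<infinity>) (at_left 1)"
    proof -
      have "filterlim g at_top (at_left 1)" unfolding g_def using p by real_asymp
      then show ?thesis by (simp add: ereal_tendsto_simps one_ereal_def)
    qed
    have 2: "set_integrable lborel (einterval 0 1) (\<lambda>t. f (g t) * g' t)"
    proof -
      have "set_integrable lborel {0<..<1} (\<lambda>t. sqrt p / 2 * b t)" using b_int by simp
      also have "?this \<longleftrightarrow> set_integrable lborel (einterval 0 1) (\<lambda>t. f (g t) * g' t)"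
        by (intro set_integrable_cong) (auto simp: einterval_def fg)
      finally show ?thesis .
    qed
    have 3: "isCont f x" for x
      unfolding f_def using base[of x] p by (intro continuous_intros) auto
    have 4: "isCont g' t" if "0 < ereal t" "ereal t < 1" for t
      unfolding g'_def using that by (intro continuous_intros) auto
    show "set_integrable lborel (einterval 0 \<infinity>) f"
      "(LBINT x=0..\<infinity>. f x) = (LBINT t=0..1. f (g t) * g' t)"
      using interval_integral_substitution_nonneg[of 0 1 g g' f 0 \<infinity>, OF _ 1 3 4 _ _ A B 2]
      by (simp_all add: f_def g'_def p less_imp_le)
  qed
  have "(LBINT t=0..1. f (g t) * g' t) = (LBINT t=0..1. sqrt p / 2 * b t)"
    by (intro interval_integral_cong) (auto simp: einterval_def fg)
  also have "\<dots> = sqrt p / 2 * (LBINT t:{0<..<1}. b t)"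
  proof -
    have "einterval 0 1 = {0<..<1}" by (auto simp: einterval_def)
    then show ?thesis by (simp add: interval_lebesgue_integral_def)
  qed
  also have "(LBINT t:{0<..<1}. b t) = integral {0<..<1} b"
    by (rule set_borel_integral_eq_integral(2)[OF b_int])
  also have "\<dots> = integral {0..1} b" by (simp add: integral_open_interval_real)
  also have "\<dots> = Beta (1 / 2) (p / 2)"
    using has_integral_Beta_real[of "1 / 2" "p / 2"] p unfolding b_def by (intro integral_unique) auto
  finally have "(LBINT x=0..\<infinity>. f x) = sqrt p / 2 * Beta (1 / 2) (p / 2)" using subst(2) by simp
  then have val: "(LBINT x:{0<..}. f x) = sqrt p / 2 * Beta (1 / 2) (p / 2)"
    by (simp add: interval_lebesgue_integral_0_infty)
  have int: "set_integrable lborel {0<..} f" using subst(1) by (simp add: zero_ereal_def)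
  have "has_bochner_integral lborel (\<lambda>x. indicator {0<..} x *\<^sub>R f x) (sqrt p / 2 * Beta (1 / 2) (p / 2))"
    using val int unfolding set_integrable_def set_lebesgue_integral_def
    by (simp add: has_bochner_integral_iff)
  then have "has_bochner_integral lborel (\<lambda>x. indicator {0..} x *\<^sub>R f x) (sqrt p / 2 * Beta (1 / 2) (p / 2))"
    by (subst has_bochner_integral_discrete_difference[where X = "{0}"]) (auto simp: indicator_def)
  then have "has_bochner_integral lborel f (2 *\<^sub>R (sqrt p / 2 * Beta (1 / 2) (p / 2)))"
    by (rule has_bochner_integral_even_function) (simp add: f_def)
  then show ?thesis by (simp add: f_def)
qed

lemma student_density_integral:
  assumes "p > 0"
  shows "integrable lborel (student_density p)" "integral\<^sup>L lborel (student_density p) = 1"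
proof -
  define c where "c = Gamma ((p + 1) / 2) / (sqrt (pi * p) * Gamma (p / 2))"
  have "has_bochner_integral lborel (\<lambda>x. c * (1 + x\<^sup>2 / p) powr (- (p + 1) / 2))
      (c * (sqrt p * Beta (1 / 2) (p / 2)))"
    by (intro has_bochner_integral_mult_right student_kernel_integral assms)
  moreover have "c * (sqrt p * Beta (1 / 2) (p / 2)) = 1"
  proof -
    have "Gamma (p / 2) \<noteq> 0" "Gamma (1 / 2 + p / 2) \<noteq> 0"
      using Gamma_real_pos[of "p / 2"] Gamma_real_pos[of "1 / 2 + p / 2"] assms by force+
    then show ?thesis
      unfolding c_def Beta_def using assms
      by (simp add: Gamma_one_half_real real_sqrt_mult add_divide_distrib add.commute)
  qed
  moreover have "student_density p = (\<lambda>x. c * (1 + x\<^sup>2 / p) powr (- (p + 1) / 2))"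
    by (simp add: fun_eq_iff student_density_def c_def)
  ultimately have "has_bochner_integral lborel (student_density p) 1" by (simp only:)
  then show "integrable lborel (student_density p)" "integral\<^sup>L lborel (student_density p) = 1"
    by (simp_all add: has_bochner_integral_iff)
qed

section \<open>The Student density relative to the normal density\<close>

definition student_log_const :: "real \<Rightarrow> real" where
  "student_log_const p = ln (Gamma (p / 2 + 1 / 2)) - ln (Gamma (p / 2)) - ln (p / 2) / 2"

lemma student_log_const_bounds:
  assumes "p > 0"
  shows "- (1 / p) / 4 \<le> student_log_const p" "student_log_const p \<le> 0"
  unfolding student_log_const_def
  using Gamma_half_ge[of "p / 2"] Gamma_half_le[of "p / 2"] assms by auto

lemma student_density_eq:
  assumes p: "p > 0"
  shows "student_density p x =
    std_normal_density x * exp (student_log_const p + log_ratio (1 / p) (x\<^sup>2))"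
proof -
  have base: "1 + x\<^sup>2 / p > 0" using p by (intro add_pos_nonneg) auto
  have "(1 + x\<^sup>2 / p) powr (- (p + 1) / 2)
      = exp (- x\<^sup>2 / 2) * exp (log_ratio (1 / p) (x\<^sup>2))"
    using base p unfolding powr_def log_ratio_def exp_add[symmetric]
    by (simp add: field_simps)
  moreover have "Gamma ((p + 1) / 2) / (sqrt (pi * p) * Gamma (p / 2))
      = 1 / sqrt (2 * pi) * exp (student_log_const p)"
  proof -
    have "exp (ln (p / 2) / 2) = sqrt (p / 2)"
      using p by (simp add: powr_def flip: powr_half_sqrt)
    moreover have half: "p / 2 + 1 / 2 = (p + 1) / 2" by simp
    moreover have "Gamma ((p + 1) / 2) > 0" "Gamma (p / 2) > 0" using p by auto
    ultimately have "exp (student_log_const p) = Gamma ((p + 1) / 2) / Gamma (p / 2) / sqrt (p / 2)"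
      unfolding student_log_const_def exp_diff half by (simp add: exp_ln)
    then show ?thesis by (simp add: real_sqrt_mult real_sqrt_divide)
  qed
  ultimately show ?thesis
    unfolding student_density_def std_normal_density_def by (simp add: exp_add)
qed

text \<open>
  In \<open>y = x\<^sup>2\<close> the logarithm \<open>G\<close> of the density ratio is at most 0 at \<open>y = 0\<close>, falls until \<open>y = 1\<close> and
  rises from there on, and it is at least 0 at \<open>y = 4\<close>.
\<close>

lemma student_normal_crossing:
  assumes p: "p \<ge> 50 / 29"
  obtains c where "0 < c" "c \<le> 2"
    "\<And>x. 0 \<le> x \<Longrightarrow> x \<le> c \<Longrightarrow> student_density p x \<le> std_normal_density x"
    "\<And>x. c \<le> x \<Longrightarrow> std_normal_density x \<le> student_density p x"
proof -
  define a where "a = 1 / p"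
  have p0: "p > 0" using p by simp
  have a: "0 < a" "a \<le> 29 / 50" using p by (auto simp: a_def field_simps)
  define l where "l = student_log_const p"
  define G where "G = (\<lambda>y. l + log_ratio a y)"
  have l: "- a / 4 \<le> l" "l \<le> 0"
    using student_log_const_bounds[OF p0] by (simp_all add: l_def a_def)
  have deriv: "(G has_real_derivative a * (y - 1) / (2 * (1 + a * y))) (at y)" if "0 \<le> y" for y
    unfolding G_def using log_ratio_has_derivative[OF a(1) that] by (auto intro!: derivative_eq_intros)
  have denom: "1 + a * y > 0" if "0 \<le> y" for y using a that by (intro add_pos_nonneg) auto
  have decr: "G v \<le> G u" if "0 \<le> u" "u \<le> v" "v \<le> 1" for u v
  proof (rule DERIV_nonpos_imp_nonincreasing[OF that(2)])
    fix y assume "u \<le> y" "y \<le> v"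
    with that have y: "0 \<le> y" "y \<le> 1" by auto
    then have "a * (y - 1) / (2 * (1 + a * y)) \<le> 0"
      using a denom[of y] by (intro divide_nonpos_pos mult_nonneg_nonpos) auto
    then show "\<exists>d. (G has_real_derivative d) (at y) \<and> d \<le> 0" using deriv[OF y(1)] by blast
  qed
  have incr: "G u \<le> G v" if "1 \<le> u" "u \<le> v" for u v
  proof (rule DERIV_nonneg_imp_nondecreasing[OF that(2)])
    fix y assume "u \<le> y" "y \<le> v"
    with that have y: "1 \<le> y" by auto
    then have "a * (y - 1) / (2 * (1 + a * y)) \<ge> 0"
      using a denom[of y] by (intro divide_nonneg_nonneg mult_nonneg_nonneg) auto
    then show "\<exists>d. (G has_real_derivative d) (at y) \<and> d \<ge> 0" using deriv[of y] y by force
  qed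
  have "G 0 \<le> 0" using l by (simp add: G_def log_ratio_def)
  then have "G 1 \<le> 0" using decr[of 0 1] by simp
  moreover have "0 \<le> G 4" using l log_ratio_at_4[OF a] by (simp add: G_def)
  ultimately have "\<exists>y\<ge>1. y \<le> 4 \<and> G y = 0"
    by (intro IVT) (auto intro!: DERIV_isCont[OF deriv])
  then obtain y0 where y0: "1 \<le> y0" "y0 \<le> 4" "G y0 = 0" by auto
  have low: "G y \<le> 0" if "0 \<le> y" "y \<le> y0" for y
    using that y0 incr[of y y0] decr[of 0 y] \<open>G 0 \<le> 0\<close> by (cases "y \<le> 1") auto
  have high: "0 \<le> G y" if "y0 \<le> y" for y using incr[of y0 y] that y0 by simp
  have dens: "student_density p x = std_normal_density x * exp (G (x\<^sup>2))" for x
    using student_density_eq[OF p0] by (simp add: G_def l_def a_def)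
  have pos: "std_normal_density x > 0" for x by (simp add: normal_density_pos)
  show ?thesis
  proof (rule that[of "sqrt y0"])
    show "0 < sqrt y0" using y0 by simp
    show "sqrt y0 \<le> 2" using y0 by (intro real_le_lsqrt) auto
    show "student_density p x \<le> std_normal_density x" if "0 \<le> x" "x \<le> sqrt y0" for x
    proof -
      have "x\<^sup>2 \<le> y0" using power_mono[OF that(2,1), of 2] y0 by simp
      then show ?thesis using low[of "x\<^sup>2"] pos[of x] by (simp add: dens)
    qed
    show "std_normal_density x \<le> student_density p x" if "sqrt y0 \<le> x" for x
    proof -
      have "y0 \<le> x\<^sup>2" using power_mono[OF that, of 2] y0 by simp
      then show ?thesis using high[of "x\<^sup>2"] pos[of x] by (simp add: dens)
    qed
  qed
qed

section \<open>Primitives of even functions with a single sign change\<close>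

lemma primitive_has_derivative:
  fixes e :: "real \<Rightarrow> real"
  assumes cont: "continuous_on UNIV e" and int: "integrable lborel e"
  shows "((\<lambda>x. LINT u:{..x}|lborel. e u) has_real_derivative e x) (at x)"
proof -
  have si: "set_integrable lborel A e" if "A \<in> sets borel" for A
    using integrable_mult_indicator[OF _ int, of A] that by (simp add: set_integrable_def)
  have split: "(LINT u:{..y}|lborel. e u) = (LINT u:{..<x - 1}|lborel. e u) + integral {x - 1..y} e"
    if "x - 1 \<le> y" for y
  proof -
    have "{..y} = {..<x - 1} \<union> {x - 1..y}" using that by auto
    then have "(LINT u:{..y}|lborel. e u) = (LINT u:{..<x - 1}|lborel. e u) + (LINT u:{x - 1..y}|lborel. e u)"
      by (simp only:) (intro set_integral_Un si; auto)
    then show ?thesis using set_borel_integral_eq_integral(2)[OF si[of "{x - 1..y}"]] by simp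
  qed
  have "((\<lambda>y. integral {x - 1..y} e) has_real_derivative e x) (at x within {x - 1..x + 1})"
    by (intro integral_has_real_derivative continuous_on_subset[OF cont]) auto
  then have "((\<lambda>y. integral {x - 1..y} e) has_real_derivative e x) (at x)"
    by (simp add: at_within_Icc_at)
  then have "((\<lambda>y. (LINT u:{..<x - 1}|lborel. e u) + integral {x - 1..y} e) has_real_derivative e x) (at x)"
    by (auto intro!: derivative_eq_intros)
  then show ?thesis
    by (rule has_field_derivative_transform_within_open[where S = "{x - 1<..}"]) (auto simp: split)
qed

text \<open>
  Reflection maps the left tail to the right tail, the complement of \<open>{..x}\<close> up to a null set.
\<close>

lemma primitive_of_even_reflect:
  fixes e :: "real \<Rightarrow> real"
  assumes int: "integrable lborel e" and even: "\<And>x. e (- x) = e x"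
  shows "(LINT u:{..- x}|lborel. e u) = integral\<^sup>L lborel e - (LINT u:{..x}|lborel. e u)"
proof -
  have si: "set_integrable lborel A e" if "A \<in> sets borel" for A
    using integrable_mult_indicator[OF _ int, of A] that by (simp add: set_integrable_def)
  have "(LINT u:{..- x}|lborel. e u) = (LINT u:{u. - u \<in> {..- x}}|lborel. e (- u))"
    by (rule set_integral_reflect)
  also have "{u. - u \<in> {..- x}} = {x..}" by auto
  also have "(LINT u:{x..}|lborel. e (- u)) = (LINT u:{x..}|lborel. e u)" by (simp add: even)
  also have "\<dots> = (LINT u:{x<..}|lborel. e u)"
  proof (rule set_integral_null_delta[OF int])
    have "{x..} - {x<..} \<union> ({x<..} - {x..}) = {x}" by auto
    then show "{x..} - {x<..} \<union> ({x<..} - {x..}) \<in> null_sets lborel"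
      by (simp add: finite_imp_null_set_lborel)
  qed auto
  also have "(LINT u:{..x}|lborel. e u) + \<dots> = (LINT u:{..x} \<union> {x<..}|lborel. e u)"
    by (intro set_integral_Un[symmetric] si) auto
  also have "{..x} \<union> {x<..} = UNIV" by auto
  finally show ?thesis by (simp add: set_lebesgue_integral_def)
qed

text \<open>
  \<open>E\<close> is odd, so only \<open>x \<ge> 0\<close> matters. There \<open>E\<close> rises from 0 to \<open>E c\<close> and then falls, but never below 0,
  since the left tail integral \<open>E (- x) = - E x\<close> has a nonpositive integrand. The positive part of \<open>e\<close>
  lives on \<open>[- c, c]\<close>, where its integral is \<open>E c - E (- c) = 2 * E c\<close>; the negative part has the same mass.
\<close>

lemma single_crossing:
  fixes e :: "real \<Rightarrow> real" and c :: real
  defines "E \<equiv> \<lambda>x. LINT u:{..x}|lborel. e u"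
  assumes cont: "continuous_on UNIV e" and int: "integrable lborel e"
    and zero: "integral\<^sup>L lborel e = 0" and even: "\<And>x. e (- x) = e x"
    and c: "0 \<le> c" and nonneg: "\<And>x. 0 \<le> x \<Longrightarrow> x \<le> c \<Longrightarrow> 0 \<le> e x"
    and nonpos: "\<And>x. c \<le> x \<Longrightarrow> e x \<le> 0"
  shows "E 0 = 0" "(SUP x. \<bar>E x\<bar>) = E c" "(LINT x|lborel. \<bar>e x\<bar>) = 4 * E c"
proof -
  have si: "set_integrable lborel A e" if "A \<in> sets borel" for A
    using integrable_mult_indicator[OF _ int, of A] that by (simp add: set_integrable_def)
  have deriv: "(E has_real_derivative e x) (at x)" for x
    unfolding E_def by (rule primitive_has_derivative[OF cont int])
  have odd: "E (- x) = - E x" for x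
    unfolding E_def using primitive_of_even_reflect[OF int even] zero by simp
  show E0: "E 0 = 0" using odd[of 0] by simp
  have bounds: "0 \<le> E x \<and> E x \<le> E c" if x: "0 \<le> x" for x
  proof (cases "x \<le> c")
    case True
    have "E 0 \<le> E x"
      by (rule DERIV_nonneg_imp_nondecreasing[OF x]) (use True deriv nonneg in force)
    moreover have "E x \<le> E c"
      by (rule DERIV_nonneg_imp_nondecreasing[OF True]) (use x deriv nonneg in force)
    ultimately show ?thesis using E0 by simp
  next
    case False
    have "E x \<le> E c"
      by (rule DERIV_nonpos_imp_nonincreasing[of c]) (use False deriv nonpos in force)+
    moreover have "0 \<le> (LINT u:{..- x}|lborel. - e u)"
      unfolding set_lebesgue_integral_def
    proof (rule Bochner_Integration.integral_nonneg)
      fix u show "0 \<le> indicator {..- x} u *\<^sub>R - e u"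
        using nonpos[of "- u"] even[of u] False by (simp add: indicator_def)
    qed
    then have "E (- x) \<le> 0" unfolding E_def by (simp add: set_integral_uminus si)
    ultimately show ?thesis using odd[of x] by simp
  qed
  have "\<bar>E x\<bar> \<le> E c" for x
    using bounds[of x] bounds[of "- x"] odd[of x] by (cases "0 \<le> x") auto
  then show "(SUP x. \<bar>E x\<bar>) = E c"
    using bounds[OF c] by (intro cSup_eq_maximum) (auto intro: rev_image_eqI[of c])
  have e_c: "e c = 0" using nonneg[of c] nonpos[of c] c by simp
  \<comment> \<open>the half-open interval matches \<open>{..c} - {..- c}\<close>; at \<open>- c\<close> both sides vanish\<close>
  have abs_eq: "\<bar>e x\<bar> = 2 * (indicator {- c<..c} x *\<^sub>R e x) - e x" for x
  proof -
    consider "x \<in> {- c<..c}" "0 \<le> x" | "x \<in> {- c<..c}" "x < 0" | "x > c" | "x \<le> - c" by fastforce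
    then show ?thesis
    proof cases
      case 1 then show ?thesis using nonneg[of x] by simp
    next
      case 2 then show ?thesis using nonneg[of "- x"] even[of x] by simp
    next
      case 3 then show ?thesis using nonpos[of x] by simp
    next
      case 4 then show ?thesis using nonpos[of "- x"] even[of x] by simp
    qed
  qed
  have "(LINT x|lborel. \<bar>e x\<bar>) = 2 * (LINT x:{- c<..c}|lborel. e x)"
    unfolding abs_eq using int si[of "{- c<..c}"] zero
    by (simp add: set_integrable_def set_lebesgue_integral_def)
  also have "E c = E (- c) + (LINT x:{- c<..c}|lborel. e x)"
  proof -
    have "{..c} = {..- c} \<union> {- c<..c}" using c by auto
    then show ?thesis unfolding E_def by (simp only:) (intro set_integral_Un si; auto)
  qed
  then have "(LINT x:{- c<..c}|lborel. e x) = 2 * E c" using odd[of c] by simp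
  finally show "(LINT x|lborel. \<bar>e x\<bar>) = 4 * E c" by simp
qed

lemma std_normal_cdf_eq: "std_normal_cdf x = (LINT u:{..x}|lborel. std_normal_density u)"
proof -
  interpret real_distribution std_normal_distribution by (rule real_dist_normal_dist)
  have "std_normal_cdf x = (LINT u|std_normal_distribution. indicator {..x} u)"
    unfolding std_normal_cdf_def cdf_def2 by simp
  also have "\<dots> = (LINT u|lborel. std_normal_density u *\<^sub>R indicator {..x} u)"
    by (intro integral_density) auto
  finally show ?thesis by (simp add: set_lebesgue_integral_def mult.commute)
qed

section \<open>The maximum of the bound\<close>

lemma std_normal_cdf_has_derivative:
  "(std_normal_cdf has_real_derivative std_normal_density x) (at x)"
proof -
  have "continuous_on UNIV std_normal_density"
    unfolding normal_density_def by (intro continuous_intros) auto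
  then show ?thesis
    unfolding std_normal_cdf_eq[abs_def] by (intro primitive_has_derivative) auto
qed

lemma B_bound_has_derivative:
  "(B_bound a has_real_derivative a / 384 * P_poly a x * std_normal_density x) (at x)"
proof -
  have "(std_normal_density has_real_derivative - x * std_normal_density x) (at x)" for x
  proof -
    have "((\<lambda>x. 1 / sqrt (2 * pi) * exp (- x\<^sup>2 / 2)) has_real_derivative
        1 / sqrt (2 * pi) * (exp (- x\<^sup>2 / 2) * - x)) (at x)"
      by (intro DERIV_cmult) (auto intro!: derivative_eq_intros)
    then show ?thesis unfolding std_normal_density_def[abs_def] by (simp add: mult_ac)
  qed
  note this[THEN DERIV_chain2, derivative_intros]
  note std_normal_cdf_has_derivative[THEN DERIV_chain2, derivative_intros]
  show ?thesis
    unfolding B_bound_def[abs_def] P_poly_def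
    by (rule derivative_eq_intros refl)+ (simp add: field_simps eval_nat_numeral)
qed

text \<open>
  The last two parts give the sign of the derivative of \<open>B_bound a\<close> on both sides of the root.
\<close>

lemma P_poly_unique_root:
  assumes "0 < a" "a < 1"
  shows "\<exists>!x. x > 0 \<and> P_poly a x = 0"
    and "0 \<le> x \<Longrightarrow> x \<le> x_tilde a \<Longrightarrow> 0 \<le> P_poly a x"
    and "0 \<le> x \<Longrightarrow> x_tilde a \<le> x \<Longrightarrow> P_poly a x \<le> 0"
proof -
  obtain Y where Y: "2 < Y" "P_sq a Y = 0"
    and pos: "\<And>y. 0 \<le> y \<Longrightarrow> y < Y \<Longrightarrow> P_sq a y > 0"
    and neg: "\<And>y. Y < y \<Longrightarrow> P_sq a y < 0"
    using P_sq_sign_change[OF assms] by metis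
  have root_iff: "x > 0 \<and> P_poly a x = 0 \<longleftrightarrow> x = sqrt Y" for x
  proof
    assume x: "x > 0 \<and> P_poly a x = 0"
    then have "x\<^sup>2 = Y"
      using pos[of "x\<^sup>2"] neg[of "x\<^sup>2"] by (cases "x\<^sup>2" Y rule: linorder_cases) (auto simp: P_poly_eq_P_sq)
    then show "x = sqrt Y" using x by (auto intro: real_sqrt_unique[symmetric])
  qed (use Y in \<open>auto simp: P_poly_eq_P_sq\<close>)
  then show "\<exists>!x. x > 0 \<and> P_poly a x = 0" by simp
  have xt: "x_tilde a = sqrt Y" unfolding x_tilde_def root_iff by simp
  show "0 \<le> P_poly a x" if "0 \<le> x" "x \<le> x_tilde a"
  proof -
    have "x\<^sup>2 \<le> Y" using power_mono[OF that(2,1), of 2] Y by (simp add: xt)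
    then show ?thesis using pos[of "x\<^sup>2"] Y by (cases "x\<^sup>2 = Y") (auto simp: P_poly_eq_P_sq)
  qed
  show "P_poly a x \<le> 0" if "0 \<le> x" "x_tilde a \<le> x"
  proof -
    have "Y \<le> x\<^sup>2" using power_mono[OF that(2), of 2] Y by (simp add: xt)
    then show ?thesis using neg[of "x\<^sup>2"] Y by (cases "x\<^sup>2 = Y") (auto simp: P_poly_eq_P_sq)
  qed
qed

lemma B_bound_le_at_x_tilde:
  assumes a: "0 < a" "a < 1" and x: "0 \<le> x"
  shows "B_bound a x \<le> B_bound a (x_tilde a)"
proof (cases "x \<le> x_tilde a")
  case True
  show ?thesis
  proof (rule DERIV_nonneg_imp_nondecreasing[OF True])
    fix t assume "x \<le> t" "t \<le> x_tilde a"
    then have "0 \<le> a / 384 * P_poly a t * std_normal_density t"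
      using a x P_poly_unique_root(2)[OF a, of t] by simp
    then show "\<exists>d. (B_bound a has_real_derivative d) (at t) \<and> d \<ge> 0"
      using B_bound_has_derivative by blast
  qed
next
  case False
  have xt: "x_tilde a > 0"
    using theI'[OF P_poly_unique_root(1)[OF a]] unfolding x_tilde_def by blast
  show ?thesis
  proof (rule DERIV_nonpos_imp_nonincreasing[of "x_tilde a" x])
    show "x_tilde a \<le> x" using False by simp
    fix t assume "x_tilde a \<le> t" "t \<le> x"
    then have "a / 384 * P_poly a t * std_normal_density t \<le> 0"
      using a xt P_poly_unique_root(3)[OF a, of t]
      by (intro mult_nonpos_nonneg mult_nonneg_nonpos) auto
    then show "\<exists>d. (B_bound a has_real_derivative d) (at t) \<and> d \<le> 0"
      using B_bound_has_derivative by blast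
  qed
qed

section \<open>The distances\<close>

theorem theorem1p3:
  fixes p :: real
  assumes "p \<ge> 50 / 29"
  shows "(\<forall>a::real. 0 < a \<and> a < 1 \<longrightarrow> (\<exists>!x. x > 0 \<and> P_poly a x = 0)) \<and>
         1 / 2 * d_TV p = d_Ko p \<and>
         d_Ko p < B_bound (1 / p) (x_tilde (1 / p))"
proof -
  define a where "a = 1 / p"
  have p0: "p > 0" using assms by simp
  have a: "0 < a" "a \<le> 29 / 50" "a < 1" using assms by (auto simp: a_def field_simps)
  define e where "e = (\<lambda>x. std_normal_density x - student_density p x)"
  define E where "E = (\<lambda>x. LINT u:{..x}|lborel. e u)"
  obtain c where c: "0 < c" "c \<le> 2"
    and below: "\<And>x. 0 \<le> x \<Longrightarrow> x \<le> c \<Longrightarrow> student_density p x \<le> std_normal_density x"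
    and above: "\<And>x. c \<le> x \<Longrightarrow> std_normal_density x \<le> student_density p x"
    using student_normal_crossing[OF assms] by metis
  have base: "1 + x\<^sup>2 / p \<noteq> 0" for x
    using p0 add_pos_nonneg[of 1 "x\<^sup>2 / p"] by force
  have cont: "continuous_on UNIV e"
    unfolding e_def student_density_def normal_density_def
    using base p0 by (intro continuous_intros) auto
  have int: "integrable lborel e"
    unfolding e_def by (intro Bochner_Integration.integrable_diff student_density_integral p0) auto
  have zero: "integral\<^sup>L lborel e = 0"
    unfolding e_def using student_density_integral[OF p0]
    by (subst Bochner_Integration.integral_diff) auto
  have even: "e (- x) = e x" for x
    by (simp add: e_def student_density_def std_normal_density_def)
  have signs: "0 \<le> c" "\<And>x. 0 \<le> x \<Longrightarrow> x \<le> c \<Longrightarrow> 0 \<le> e x" "\<And>x. c \<le> x \<Longrightarrow> e x \<le> 0"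
    using c below above by (auto simp: e_def)
  have crossing: "E 0 = 0" "(SUP x. \<bar>E x\<bar>) = E c" "(LINT x|lborel. \<bar>e x\<bar>) = 4 * E c"
    unfolding E_def using single_crossing[OF cont int zero even signs] by blast+
  have si: "set_integrable lborel {..x} f" if "integrable lborel f" for x and f :: "real \<Rightarrow> real"
    using integrable_mult_indicator[OF _ that, of "{..x}"] by (simp add: set_integrable_def)
  have "E x = std_normal_cdf x - student_cdf p x" for x
    unfolding E_def e_def std_normal_cdf_eq student_cdf_def
    by (intro set_integral_diff si student_density_integral p0) auto
  then have Ko: "d_Ko p = E c"
    using crossing(2) by (simp add: d_Ko_def abs_minus_commute)
  have TV: "d_TV p = 2 * E c"
    using crossing(3) by (simp add: d_TV_def e_def abs_minus_commute)
  \<comment> \<open>the derivative of the difference is \<open>f - \<phi> * ratio_lower\<close>, positive since \<open>x\<^sup>2 \<le> c\<^sup>2 \<le> 4\<close>\<close>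
  have "B_bound a 0 - E 0 < B_bound a c - E c"
  proof (rule DERIV_pos_imp_increasing[OF c(1)])
    fix x assume x: "0 \<le> x" "x \<le> c"
    define d where "d = a / 384 * P_poly a x * std_normal_density x - e x"
    have "((\<lambda>x. B_bound a x - E x) has_real_derivative d) (at x)"
      unfolding d_def E_def
      by (intro DERIV_diff B_bound_has_derivative primitive_has_derivative cont int)
    moreover have "d > 0"
    proof -
      have "x\<^sup>2 \<le> 4" using power_mono[of x 2 2] x c by simp
      then have "ratio_lower a (x\<^sup>2) < exp (- a / 4 + log_ratio a (x\<^sup>2))"
        using a by (intro ratio_lower_less) auto
      also have "\<dots> \<le> exp (student_log_const p + log_ratio a (x\<^sup>2))"
        using student_log_const_bounds(1)[OF p0] by (simp add: a_def)
      finally have "std_normal_density x * ratio_lower a (x\<^sup>2) < student_density p x"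
        unfolding student_density_eq[OF p0] a_def
        by (intro mult_strict_left_mono) (auto simp: normal_density_pos)
      then show ?thesis
        by (simp add: d_def e_def ratio_lower_def P_poly_eq_P_sq algebra_simps)
    qed
    ultimately show "\<exists>d. ((\<lambda>x. B_bound a x - E x) has_real_derivative d) (at x) \<and> d > 0"
      by blast
  qed
  moreover have "B_bound a 0 = 0"
  proof -
    have "std_normal_cdf (- 0) = 1 - std_normal_cdf 0"
      unfolding std_normal_cdf_eq
      by (subst primitive_of_even_reflect) (auto simp: std_normal_density_def)
    then have "std_normal_cdf 0 = 1 / 2" by simp
    then show ?thesis by (simp add: B_bound_def)
  qed
  ultimately have "E c < B_bound a c" using crossing(1) by simp
  also have "\<dots> \<le> B_bound a (x_tilde a)"
    using B_bound_le_at_x_tilde a c by simp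
  finally show ?thesis
    using Ko TV P_poly_unique_root(1) by (simp add: a_def)
qed

end
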